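(* Let $\mathcal{H}$ be a complex Hilbert space, let $N\geqslant 2$, and let $A_1,\ldots,A_N$ be bounded self-adjoint operators in $\mathcal{H}$ such that $A_iA_j$ is compact for all $i\neq j$. If $\mathrm{Ran}(A_i)$ is closed for $i=1,\ldots,N$, then $\sum_{i=1}^N\mathrm{Ran}(A_i)$ is closed.
   Context: $\mathrm{Ran}$ denotes the range of an operator, and $\sum_{i=1}^N \mathrm{Ran}(A_i)=\{\sum_{i=1}^N A_ix_i \mid x_i\in\mathcal{H}\}$ is the algebraic sum of the ranges. *)

theory Defs
  imports "HOL-Analysis.Analysis"
begin

class complex_vector = real_vector +
  fixes scaleC :: "complex \<Rightarrow> 'a \<Rightarrow> 'a"  (infixr "*\<^sub>C" 75)
  assumes scaleC_add_right: "a *\<^sub>C (x + y) = a *\<^sub>C x + a *\<^sub>C y"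
    and scaleC_add_left: "(a + b) *\<^sub>C x = a *\<^sub>C x + b *\<^sub>C x"
    and scaleC_scaleC: "a *\<^sub>C b *\<^sub>C x = (a * b) *\<^sub>C x"
    and scaleC_one: "1 *\<^sub>C x = x"
    and scaleR_scaleC: "r *\<^sub>R x = complex_of_real r *\<^sub>C x"

text \<open>
  The inner product is linear in the first argument and conjugate-linear in the second.
  By \<open>cinner_commute\<close>, \<open>cinner x x\<close> is real, so taking its real part loses nothing.
\<close>

class complex_inner = complex_vector + real_normed_vector +
  fixes cinner :: "'a \<Rightarrow> 'a \<Rightarrow> complex"
  assumes cinner_commute: "cinner x y = cnj (cinner y x)"
    and cinner_add_left: "cinner (x + y) z = cinner x z + cinner y z"
    and cinner_scaleC_left: "cinner (a *\<^sub>C x) y = a * cinner x y"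
    and cinner_ge_zero: "0 \<le> Re (cinner x x)"
    and cinner_eq_zero_iff: "cinner x x = 0 \<longleftrightarrow> x = 0"
    and norm_eq_sqrt_cinner: "norm x = sqrt (Re (cinner x x))"

class complex_hilbert_space = complex_inner + complete_space

instantiation complex :: complex_hilbert_space
begin

definition scaleC_complex :: "complex \<Rightarrow> complex \<Rightarrow> complex"
  where "scaleC_complex a x = a * x"

definition cinner_complex :: "complex \<Rightarrow> complex \<Rightarrow> complex"
  where "cinner_complex x y = x * cnj y"

instance
proof
  fix x :: complex
  show "norm x = sqrt (Re (cinner x x))"
    by (simp add: cinner_complex_def cmod_def power2_eq_square)
qed (auto simp: scaleC_complex_def cinner_complex_def algebra_simps scaleR_conv_of_real)

end

definition bounded_clinear ::
    "('a::{complex_vector,real_normed_vector} \<Rightarrow> 'b::{complex_vector,real_normed_vector}) \<Rightarrow> bool"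
  where "bounded_clinear A \<longleftrightarrow>
    bounded_linear A \<and> (\<forall>c x. A (c *\<^sub>C x) = c *\<^sub>C A x)"

definition is_adjoint :: "('b::complex_inner \<Rightarrow> 'a) \<Rightarrow> ('a::complex_inner \<Rightarrow> 'b) \<Rightarrow> bool"
  where "is_adjoint B A \<longleftrightarrow> (\<forall>x y. cinner (A x) y = cinner x (B y))"

definition self_adjoint :: "('a::complex_inner \<Rightarrow> 'a) \<Rightarrow> bool"
  where "self_adjoint A \<longleftrightarrow> is_adjoint A A"

definition compact_operator ::
    "('a::{complex_vector,real_normed_vector} \<Rightarrow> 'b::{complex_vector,real_normed_vector}) \<Rightarrow> bool"
  where "compact_operator A \<longleftrightarrow>
    bounded_clinear A \<and> (\<forall>S. bounded S \<longrightarrow> compact (closure (A ` S)))"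

definition sum_of_ranges :: "nat \<Rightarrow> (nat \<Rightarrow> 'a \<Rightarrow> 'b::comm_monoid_add) \<Rightarrow> 'b set"
  where "sum_of_ranges N A = {\<Sum>i=1..N. A i (x i) | x. True}"

end

theory Submission
  imports Defs
begin

text \<open>
  By the open mapping theorem, every \<open>x \<in> Ran(A\<^sub>i)\<close> is \<open>A\<^sub>i u\<close> with \<open>u\<close> bounded by \<open>x\<close>, and then
  \<open>\<parallel>x\<parallel>\<^sup>2 = \<langle>A\<^sub>i u, x\<rangle> = \<langle>u, A\<^sub>i x\<rangle>\<close> bounds \<open>x\<close> by \<open>A\<^sub>i x\<close>. Let \<open>x\<^sub>i\<^sup>n \<in> Ran(A\<^sub>i)\<close> be bounded with
  \<open>\<Sum>\<^sub>i x\<^sub>i\<^sup>n\<close> convergent. For \<open>i \<noteq> j\<close> compactness of \<open>A\<^sub>j A\<^sub>i\<close> makes \<open>A\<^sub>j x\<^sub>i\<^sup>n = A\<^sub>j A\<^sub>i u\<^sub>i\<^sup>n\<close> converge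
  along a subsequence; applying \<open>A\<^sub>j\<close> to the sum, so does \<open>A\<^sub>j x\<^sub>j\<^sup>n\<close>, and hence \<open>x\<^sub>j\<^sup>n\<close>. So
  bounded tuples with convergent sums have convergent subsequences, which forces the set of all
  sums to be closed.
\<close>

instance complex_hilbert_space \<subseteq> banach ..

section \<open>Operators with closed range\<close>

text \<open>A Baire category argument: the closed range is completely metrizable and is the union of
  the closures \<open>E n\<close> of the images of balls, so some \<open>E n\<close> has relative
  interior. Points of a closure are only limits of images, hence the error \<delta>.\<close>

lemma closed_range_almost_preimages:
  fixes A :: "'a::real_normed_vector \<Rightarrow> 'b::banach"
  assumes A: "bounded_linear A" and cl: "closed (range A)"
  obtains M where "M \<ge> 0" and
    "\<And>y \<delta>. y \<in> range A \<Longrightarrow> \<delta> > 0 \<Longrightarrow> \<exists>u. norm u \<le> M * norm y \<and> norm (y - A u) < \<delta>"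
proof -
  interpret A: bounded_linear A by fact
  define E where "E n = closure (A ` cball 0 (real n))" for n
  let ?X = "top_of_set (range A)"
  have E_sub: "E n \<subseteq> range A" for n
    unfolding E_def by (rule closure_minimal) (use cl in auto)
  have "range A \<subseteq> \<Union> (range E)"
  proof clarsimp
    fix x :: 'a
    obtain n where "norm x \<le> real n" using real_arch_simple by blast
    then have "A x \<in> E n" unfolding E_def by (intro closure_subset[THEN subsetD]) auto
    then show "\<exists>n. A x \<in> E n" ..
  qed
  then have "\<Union> (range E) = range A" using E_sub by auto
  then have "?X interior_of \<Union> (range E) \<noteq> {}"
    using interior_of_topspace[of ?X] by auto
  moreover have "completely_metrizable_space ?X"
    using cl by (intro completely_metrizable_space_closedin completely_metrizable_space_euclidean) simp
  moreover have "closedin ?X (E n)" for n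
    using E_sub by (simp add: E_def closed_subset)
  ultimately obtain n where "?X interior_of E n \<noteq> {}"
    using Baire_category_alt[of ?X "range E"] by auto
  then obtain y0 T where T: "openin ?X T" "y0 \<in> T" "T \<subseteq> E n"
    by (auto simp: interior_of_def)
  then obtain e where e: "e > 0" "ball y0 e \<inter> range A \<subseteq> E n"
    by (metis openin_contains_ball subset_trans)
  have y0: "y0 \<in> E n" using T by auto
  have y0R: "y0 \<in> range A" using y0 E_sub by auto
  have approx: "\<exists>u. norm u \<le> real n \<and> norm (z - A u) < \<delta>" if "z \<in> E n" "\<delta> > 0" for z \<delta>
    using that unfolding E_def closure_approachable
    by (force simp: dist_norm norm_minus_commute)
  \<comment> \<open>Two approximate preimages of norm at most \<open>n\<close> differ by at most
    \<open>2 * n\<close>; dividing by the scale \<open>t = e / (2 * norm y)\<close> below produces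
    this constant.\<close>
  define M where "M = 4 * real n / e"
  show thesis
  proof
    show "M \<ge> 0" using e by (simp add: M_def)
    fix y and \<delta> :: real assume y: "y \<in> range A" and \<delta>: "\<delta> > 0"
    show "\<exists>u. norm u \<le> M * norm y \<and> norm (y - A u) < \<delta>"
    proof (cases "y = 0")
      case True then show ?thesis using \<delta> by (intro exI[of _ 0]) (simp add: A.zero)
    next
      case False
      \<comment> \<open>This scale gives \<open>t *\<^sub>R y\<close> norm \<open>e / 2\<close>, so
        the shifted point stays in the ball. Each of the two approximations is allowed the error
        \<open>t * \<delta> / 2\<close>, which leaves less than \<delta> after division by
        \<open>t\<close>.\<close>
      define t where "t = e / (2 * norm y)"
      have t: "t > 0" using e False by (simp add: t_def)
      obtain x x0 where x: "y = A x" "y0 = A x0" using y y0R by auto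
      have "y0 + t *\<^sub>R y = A (x0 + t *\<^sub>R x)" by (simp add: x A.add A.scaleR)
      moreover have "y0 + t *\<^sub>R y \<in> ball y0 e"
        using e False by (simp add: dist_norm t_def)
      ultimately have "y0 + t *\<^sub>R y \<in> E n" using e by auto
      then obtain u where u: "norm u \<le> real n" "norm (y0 + t *\<^sub>R y - A u) < t * \<delta> / 2"
        using approx[of "y0 + t *\<^sub>R y" "t * \<delta> / 2"] t \<delta> by auto
      obtain v where v: "norm v \<le> real n" "norm (y0 - A v) < t * \<delta> / 2"
        using approx[of y0 "t * \<delta> / 2"] y0 t \<delta> by auto
      define w where "w = (1 / t) *\<^sub>R (u - v)"
      have "norm (u - v) \<le> 2 * real n"
        using norm_triangle_ineq4[of u v] u v by linarith
      then have "norm w \<le> 2 * real n / t"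
        using t by (simp add: w_def divide_right_mono)
      also have "\<dots> = M * norm y" using e False by (simp add: M_def t_def)
      finally have "norm w \<le> M * norm y" .
      have "t *\<^sub>R (y - A w) = (y0 + t *\<^sub>R y - A u) - (y0 - A v)"
        using t by (simp add: w_def A.scaleR A.diff algebra_simps)
      then have "norm (t *\<^sub>R (y - A w)) < t * \<delta>"
        using norm_triangle_ineq4[of "y0 + t *\<^sub>R y - A u" "y0 - A v"] u v by simp
      then have "norm (y - A w) < \<delta>" using t by simp
      with \<open>norm w \<le> M * norm y\<close> show ?thesis by blast
    qed
  qed
qed

text \<open>Successive approximation: each approximate preimage halves the residual, so the
  corrections are dominated by a geometric series. Completeness of the domain sums them to an exact
  preimage, with constant \<open>2 * M\<close>.\<close>

lemma closed_range_bounded_preimages: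
  fixes A :: "'a::banach \<Rightarrow> 'b::banach"
  assumes A: "bounded_linear A" and cl: "closed (range A)"
  obtains C where "C \<ge> 0" and "\<And>y. y \<in> range A \<Longrightarrow> \<exists>u. A u = y \<and> norm u \<le> C * norm y"
proof -
  interpret A: bounded_linear A by fact
  obtain M where M: "M \<ge> 0"
    "\<And>y \<delta>. y \<in> range A \<Longrightarrow> \<delta> > 0 \<Longrightarrow> \<exists>u. norm u \<le> M * norm y \<and> norm (y - A u) < \<delta>"
    using closed_range_almost_preimages[OF A cl] by blast
  have "\<exists>u. norm u \<le> M * norm y \<and> norm (y - A u) \<le> norm y / 2" if "y \<in> range A" for y
  proof (cases "y = 0")
    case True then show ?thesis by (intro exI[of _ 0]) (simp add: A.zero)
  next
    case False then show ?thesis using M(2)[OF that, of "norm y / 2"] by force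
  qed
  then obtain g where g: "\<And>y. y \<in> range A \<Longrightarrow> norm (g y) \<le> M * norm y"
    "\<And>y. y \<in> range A \<Longrightarrow> norm (y - A (g y)) \<le> norm y / 2"
    by metis
  show thesis
  proof
    show "2 * M \<ge> 0" using M by simp
    fix y assume y: "y \<in> range A"
    \<comment> \<open>The residual of \<open>y\<close> after \<open>n\<close> corrections; its
      consecutive differences \<open>A (g (r n))\<close> telescope to \<open>y\<close>.\<close>
    define r where "r n = ((\<lambda>z. z - A (g z)) ^^ n) y" for n
    have r_Suc: "r (Suc n) = r n - A (g (r n))" for n by (simp add: r_def)
    have r_range: "r n \<in> range A" for n
    proof (induction n)
      case 0 show ?case using y by (simp add: r_def)
    next
      case (Suc n)
      then obtain x where "r n = A x" by auto
      then have "r (Suc n) = A (x - g (r n))" by (simp add: r_Suc A.diff)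
      then show ?case by auto
    qed
    have r_norm: "norm (r n) \<le> norm y * (1/2) ^ n" for n
    proof (induction n)
      case 0 show ?case by (simp add: r_def)
    next
      case (Suc n)
      then show ?case using g(2)[OF r_range[of n]] by (simp add: r_Suc)
    qed
    have g_norm: "norm (g (r n)) \<le> M * norm y * (1/2) ^ n" for n
      using g(1)[OF r_range[of n]] mult_left_mono[OF r_norm[of n] M(1)] by (simp add: mult.assoc)
    have geom: "(\<lambda>n. M * norm y * (1/2) ^ n) sums (2 * M * norm y)"
      using sums_mult[OF geometric_sums[of "1/2::real"], of "M * norm y"] by (simp add: mult_ac)
    have sn: "summable (\<lambda>n. norm (g (r n)))"
      by (rule summable_comparison_test'[OF sums_summable[OF geom], of 0]) (use g_norm in auto)
    then have s: "summable (\<lambda>n. g (r n))" by (rule summable_norm_cancel)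
    have "(\<lambda>n. norm y * (1/2) ^ n) \<longlonglongrightarrow> 0"
      by (intro tendsto_mult_right_zero LIMSEQ_power_zero) simp
    then have "r \<longlonglongrightarrow> 0"
      by (rule Lim_null_comparison[rotated]) (use r_norm in auto)
    then have "(\<lambda>n. r n - r (Suc n)) sums (r 0 - 0)"
      by (rule telescope_sums')
    then have "(\<lambda>n. A (g (r n))) sums y" by (simp add: r_Suc) (simp add: r_def)
    moreover have "(\<lambda>n. A (g (r n))) sums A (\<Sum>n. g (r n))"
      using s by (intro A.sums summable_sums)
    ultimately have "A (\<Sum>n. g (r n)) = y" by (simp add: sums_unique2)
    moreover have "norm (\<Sum>n. g (r n)) \<le> 2 * M * norm y"
      using summable_norm[OF sn] suminf_le[OF g_norm sn sums_summable[OF geom]] sums_unique[OF geom]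
      by linarith
    ultimately show "\<exists>u. A u = y \<and> norm u \<le> 2 * M * norm y" by blast
  qed
qed

section \<open>Self-adjoint operators with closed range are bounded below on their range\<close>

lemma cinner_self: "cinner (x::'a::complex_inner) x = complex_of_real ((norm x)\<^sup>2)"
proof -
  have "Im (cinner x x) = - Im (cinner x x)"
    by (metis cinner_commute cnj.simps(2))
  then show ?thesis
    by (simp add: complex_eq_iff norm_eq_sqrt_cinner cinner_ge_zero)
qed

lemma Re_cinner_commute: "Re (cinner (x::'a::complex_inner) y) = Re (cinner y x)"
  by (metis cinner_commute cnj.simps(1))

lemma cinner_diff_left: "cinner (x - y) z = cinner x z - cinner (y::'a::complex_inner) z"
  using cinner_add_left[of "x - y" y z] by simp

lemma norm_diff_square:
  fixes x y :: "'a::complex_inner"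
  shows "(norm (x - y))\<^sup>2 = (norm x)\<^sup>2 + (norm y)\<^sup>2 - 2 * Re (cinner x y)"
proof -
  have "(norm (x - y))\<^sup>2 = Re (cinner (x - y) (x - y))"
    by (simp add: cinner_self)
  also have "\<dots> = Re (cinner (x - y) x) - Re (cinner (x - y) y)"
    by (simp add: cinner_diff_left Re_cinner_commute[of _ "x - y"])
  finally show ?thesis
    by (simp add: cinner_diff_left cinner_self Re_cinner_commute[of y x])
qed

text \<open>Since the norm of the class already satisfies the triangle inequality, Cauchy--Schwarz
  follows from \<open>\<bar>norm x - norm y\<bar> \<le> norm (x - y)\<close> by expanding squares.\<close>

lemma Re_cinner_le: "Re (cinner (x::'a::complex_inner) y) \<le> norm x * norm y"
proof -
  have "(norm x - norm y)\<^sup>2 \<le> (norm (x - y))\<^sup>2"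
    using power_mono[OF norm_triangle_ineq3[of x y], of 2] by simp
  then show ?thesis
    by (simp add: norm_diff_square power2_diff)
qed

text \<open>Self-adjointness makes range and kernel orthogonal; the controlled preimage
  \<open>u\<close> makes this quantitative. Moving \<open>A\<close> across the inner product and
  applying Cauchy-Schwarz leaves a factor \<open>norm x\<close> to cancel.\<close>

lemma self_adjoint_bounded_below_on_range:
  fixes A :: "'a::complex_hilbert_space \<Rightarrow> 'a"
  assumes sa: "self_adjoint A" and "C \<ge> 0"
    and C: "\<And>y. y \<in> range A \<Longrightarrow> \<exists>u. A u = y \<and> norm u \<le> C * norm y"
    and x: "x \<in> range A"
  shows "norm x \<le> C * norm (A x)"
proof (cases "x = 0")
  case False
  obtain u where u: "A u = x" "norm u \<le> C * norm x" using C[OF x] by auto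
  have "(norm x)\<^sup>2 = Re (cinner (A u) x)" by (simp add: u cinner_self)
  also have "\<dots> = Re (cinner u (A x))"
    using sa by (simp add: self_adjoint_def is_adjoint_def)
  also have "\<dots> \<le> norm u * norm (A x)" by (rule Re_cinner_le)
  also have "\<dots> \<le> C * norm x * norm (A x)" using u by (simp add: mult_right_mono)
  finally have "norm x * norm x \<le> norm x * (C * norm (A x))"
    by (simp add: power2_eq_square mult_ac)
  then show ?thesis using False by simp
next
  case True
  then show ?thesis using \<open>C \<ge> 0\<close> by simp
qed

section \<open>Finitely many sequences\<close>

text \<open>Passing to a further subsequence for a new index keeps the convergence already obtained
  for the earlier ones.\<close>

lemma common_convergent_subsequence:
  fixes f :: "'i \<Rightarrow> nat \<Rightarrow> 'a::metric_space"
  assumes "finite I" and "\<And>i. i \<in> I \<Longrightarrow> compact (K i)"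
    and "\<And>i n. i \<in> I \<Longrightarrow> f i n \<in> K i"
  shows "\<exists>r::nat \<Rightarrow> nat. strict_mono r \<and> (\<forall>i\<in>I. convergent (f i \<circ> r))"
  using assms
proof (induction I)
  case empty
  show ?case by (intro exI[of _ id]) (simp add: strict_mono_def)
next
  case (insert i I)
  then obtain r where r: "strict_mono r" "\<And>j. j \<in> I \<Longrightarrow> convergent (f j \<circ> r)" by blast
  have "seq_compact (K i)" "\<forall>n. (f i \<circ> r) n \<in> K i"
    using insert.prems by (auto simp: compact_eq_seq_compact_metric)
  then obtain l q where q: "strict_mono q" "((f i \<circ> r) \<circ> q) \<longlonglongrightarrow> l"
    unfolding seq_compact_def by metis
  show ?case
  proof (intro exI conjI ballI)
    show "strict_mono (r \<circ> q)" using r q by (simp add: strict_mono_o)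
    fix j assume "j \<in> insert i I"
    then show "convergent (f j \<circ> (r \<circ> q))"
      using q r convergent_subseq_convergent[of "f j \<circ> r" q]
      by (auto simp: convergent_def o_assoc)
  qed
qed

text \<open>Preimages (under summation) of almost minimal norm stay bounded:
  otherwise, normalising them gives a limit \<open>z\<close> in the kernel, and subtracting a multiple of \<open>z\<close>
  shrinks a preimage below the minimum.\<close>

lemma closed_sum_of_subspaces:
  fixes R :: "'i \<Rightarrow> 'a::real_normed_vector set"
  assumes fin: "finite I" and sub: "\<And>i. i \<in> I \<Longrightarrow> subspace (R i)"
    and cl: "\<And>i. i \<in> I \<Longrightarrow> closed (R i)"
    and comp: "\<And>x B. (\<And>i n. i \<in> I \<Longrightarrow> x n i \<in> R i) \<Longrightarrow>
        (\<And>i n. i \<in> I \<Longrightarrow> norm (x n i) \<le> B) \<Longrightarrow> convergent (\<lambda>n. \<Sum>i\<in>I. x n i) \<Longrightarrow>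
        \<exists>r::nat \<Rightarrow> nat. strict_mono r \<and> (\<forall>i\<in>I. convergent (\<lambda>n. x (r n) i))"
  shows "closed {\<Sum>i\<in>I. x i | x. \<forall>i\<in>I. x i \<in> R i}" (is "closed ?S")
proof -
  define N where "N x = (\<Sum>i\<in>I. norm (x i))" for x :: "'i \<Rightarrow> 'a"
  define P where "P y = {x. (\<forall>i\<in>I. x i \<in> R i) \<and> (\<Sum>i\<in>I. x i) = y}" for y
  have N_nonneg: "N x \<ge> 0" for x by (simp add: N_def sum_nonneg)
  have norm_le_N: "norm (x i) \<le> N x" if "i \<in> I" for x i
    unfolding N_def using fin that by (intro member_le_sum) auto
  have limit: "\<exists>r z. strict_mono (r::nat \<Rightarrow> nat) \<and> z \<in> P y \<and> (\<forall>i\<in>I. (\<lambda>n. x (r n) i) \<longlonglongrightarrow> z i)"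
    if xR: "\<And>n i. i \<in> I \<Longrightarrow> x n i \<in> R i" and xB: "\<And>n. N (x n) \<le> B"
      and lim: "(\<lambda>n. \<Sum>i\<in>I. x n i) \<longlonglongrightarrow> y" for x B y
  proof -
    have "norm (x n i) \<le> B" if "i \<in> I" for i n
      using norm_le_N[OF that, of "x n"] xB[of n] by linarith
    moreover have "convergent (\<lambda>n. \<Sum>i\<in>I. x n i)" using lim by (auto simp: convergent_def)
    ultimately obtain r where r: "strict_mono (r::nat \<Rightarrow> nat)"
      "\<And>i. i \<in> I \<Longrightarrow> convergent (\<lambda>n. x (r n) i)"
      using comp[of x B] xR by blast
    then obtain z where z: "\<And>i. i \<in> I \<Longrightarrow> (\<lambda>n. x (r n) i) \<longlonglongrightarrow> z i"
      unfolding convergent_def by metis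
    have "z i \<in> R i" if "i \<in> I" for i
      using closed_sequentially[OF cl[OF that] _ z[OF that]] xR that by auto
    moreover have "(\<lambda>n. \<Sum>i\<in>I. x (r n) i) \<longlonglongrightarrow> (\<Sum>i\<in>I. z i)"
      using z by (intro tendsto_sum)
    then have "(\<Sum>i\<in>I. z i) = y"
      using LIMSEQ_subseq_LIMSEQ[OF lim r(1)] by (auto simp: o_def intro: LIMSEQ_unique)
    ultimately show ?thesis using r(1) z by (auto simp: P_def)
  qed
  have near_min: "\<exists>x\<in>P y. \<forall>x'\<in>P y. N x \<le> 2 * N x'" if "P y \<noteq> {}" for y
  proof (cases "\<exists>x\<in>P y. N x = 0")
    case True
    then obtain x where "x \<in> P y" "N x = 0" by auto
    then show ?thesis using N_nonneg by (intro bexI[of _ x]) auto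
  next
    case False
    define m where "m = (INF x\<in>P y. N x)"
    have bdd: "bdd_below (N ` P y)" using N_nonneg by (intro bdd_belowI2[of _ 0]) auto
    have m_le: "m \<le> N x'" if "x' \<in> P y" for x'
      unfolding m_def using bdd that by (rule cINF_lower)
    show ?thesis
    proof (cases "m > 0")
      case True
      then have "m < 2 * m" by simp
      then obtain x where "x \<in> P y" "N x < 2 * m"
        unfolding m_def using cINF_less_iff[OF \<open>P y \<noteq> {}\<close> bdd] by blast
      then show ?thesis using m_le by force
    next
      \<comment> \<open>An infimum zero that is not attained is impossible: tuples with
        \<open>N\<close> tending to zero force \<open>y = 0\<close>, and then the zero tuple attains
        it.\<close>
      case m: False
      have "\<exists>x\<in>P y. N x < inverse (real (Suc n))" for n
        using m cINF_less_iff[OF \<open>P y \<noteq> {}\<close> bdd, of "inverse (real (Suc n))"]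
        unfolding m_def by (smt (verit) inverse_positive_iff_positive of_nat_0_less_iff zero_less_Suc)
      then obtain x where x: "\<And>n. x n \<in> P y" "\<And>n. N (x n) < inverse (real (Suc n))" by metis
      have "(\<lambda>n. \<Sum>i\<in>I. x n i) \<longlonglongrightarrow> 0"
        by (rule Lim_null_comparison[OF _ LIMSEQ_inverse_real_of_nat])
          (use x(2) in \<open>auto simp: N_def intro!: always_eventually less_imp_le order.trans[OF norm_sum]\<close>)
      moreover have "(\<lambda>n. \<Sum>i\<in>I. x n i) = (\<lambda>n. y)" using x(1) by (auto simp: P_def)
      ultimately have "y = 0" by (simp add: LIMSEQ_const_iff)
      then have "(\<lambda>i. 0) \<in> P y" using sub by (auto simp: P_def subspace_0)
      moreover have "N (\<lambda>i. 0) = 0" by (simp add: N_def)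
      ultimately show ?thesis using False by blast
    qed
  qed
  have "y \<in> ?S" if y: "\<And>n. s n \<in> ?S" "s \<longlonglongrightarrow> y" for s y
  proof -
    have "P (s n) \<noteq> {}" for n using y(1)[of n] by (auto simp: P_def)
    then have "\<forall>n. \<exists>x. x \<in> P (s n) \<and> (\<forall>x'\<in>P (s n). N x \<le> 2 * N x')"
      using near_min by blast
    then obtain x where x: "\<And>n. x n \<in> P (s n)" "\<And>n x'. x' \<in> P (s n) \<Longrightarrow> N (x n) \<le> 2 * N x'"
      by metis
    have xR: "x n i \<in> R i" if "i \<in> I" for n i using x(1) that by (auto simp: P_def)
    have xs: "(\<Sum>i\<in>I. x n i) = s n" for n using x(1) by (auto simp: P_def)
    have "\<exists>B. \<forall>n. N (x n) \<le> B"
    proof (rule ccontr)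
      assume "\<not> ?thesis"
      then have "\<exists>k. N (x k) > real (Suc n)" for n by (meson not_le)
      then obtain k where k: "\<And>n. N (x (k n)) > real (Suc n)" by metis
      define t where "t n = inverse (N (x (k n)))" for n
      have N_pos: "N (x (k n)) > 0" for n using k[of n] by linarith
      have t: "t n > 0" "t n \<le> inverse (real (Suc n))" for n
        using k[of n] N_pos[of n] by (auto simp: t_def intro!: le_imp_inverse_le)
      define w where "w n i = t n *\<^sub>R x (k n) i" for n i
      have N_w: "N (w n) = 1" for n
        using t(1)[of n] N_pos[of n]
        by (simp add: w_def N_def flip: sum_distrib_left) (simp add: t_def N_def)
      obtain b where b: "\<And>n. norm (s n) \<le> b"
        using convergent_imp_Bseq[of s] y(2) by (auto simp: convergent_def Bseq_def)
      have "b \<ge> 0" using b[of 0] norm_ge_zero order.trans by blast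
      \<comment> \<open>The sum of \<open>w n\<close> is \<open>t n\<close> times a term of the
        bounded sequence \<open>s\<close>, and \<open>t n\<close> tends to zero, while
        \<open>N (w n)\<close> stays 1.\<close>
      have "(\<lambda>n. \<Sum>i\<in>I. w n i) \<longlonglongrightarrow> 0"
      proof (rule Lim_null_comparison)
        show "(\<lambda>n. inverse (real (Suc n)) * b) \<longlonglongrightarrow> 0"
          by (intro tendsto_mult_left_zero LIMSEQ_inverse_real_of_nat)
        show "\<forall>\<^sub>F n in sequentially. norm (\<Sum>i\<in>I. w n i) \<le> inverse (real (Suc n)) * b"
          using t b \<open>b \<ge> 0\<close>
          by (intro always_eventually allI)
            (auto simp: w_def xs less_imp_le simp flip: scaleR_sum_right intro!: mult_mono)
      qed
      then obtain r z where r: "strict_mono (r::nat \<Rightarrow> nat)" and z: "z \<in> P 0"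
        and lim: "\<And>i. i \<in> I \<Longrightarrow> (\<lambda>n. w (r n) i) \<longlonglongrightarrow> z i"
        using limit[of w 1 0] N_w xR sub by (force simp: w_def subspace_scale)
      have "(\<lambda>n. N (\<lambda>i. w (r n) i - z i)) \<longlonglongrightarrow> (\<Sum>i\<in>I. norm (z i - z i))"
        unfolding N_def by (intro tendsto_sum tendsto_norm tendsto_diff lim tendsto_const)
      then have "(\<lambda>n. N (\<lambda>i. w (r n) i - z i)) \<longlonglongrightarrow> 0" by simp
      then have "\<forall>\<^sub>F n in sequentially. N (\<lambda>i. w (r n) i - z i) < 1/2"
        by (rule order_tendstoD) simp
      \<comment> \<open>The threshold \<open>1/2\<close> is chosen to beat the factor 2 of
        near-minimality.\<close>
      then obtain n where n: "N (\<lambda>i. w (r n) i - z i) < 1/2"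
        by (auto simp: eventually_sequentially)
      define c where "c = N (x (k (r n)))"
      have c: "c > 0" "c * t (r n) = 1" using N_pos[of "r n"] by (auto simp: c_def t_def)
      have eq: "x (k (r n)) i - c *\<^sub>R z i = c *\<^sub>R (w (r n) i - z i)" for i
        using c(2) by (simp add: w_def algebra_simps)
      \<comment> \<open>Since \<open>z\<close> sums to zero, subtracting a multiple of it gives a
        competitor with the same sum.\<close>
      have "(\<lambda>i. x (k (r n)) i - c *\<^sub>R z i) \<in> P (s (k (r n)))"
        using z x(1)[of "k (r n)"] sub
        by (auto simp: P_def sum_subtractf subspace_diff subspace_scale simp flip: scaleR_sum_right)
      then have "c \<le> 2 * N (\<lambda>i. x (k (r n)) i - c *\<^sub>R z i)"
        unfolding c_def by (rule x(2))
      also have "\<dots> = c * (2 * N (\<lambda>i. w (r n) i - z i))"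
        using c(1) by (simp add: eq N_def flip: sum_distrib_left)
      also have "\<dots> < c * 1" using c(1) n by (intro mult_strict_left_mono) auto
      finally show False by simp
    qed
    then obtain B where "\<And>n. N (x n) \<le> B" by auto
    then obtain z where "z \<in> P y" using limit[of x B y] xR y(2) xs by auto
    then show ?thesis by (auto simp: P_def)
  qed
  then show ?thesis unfolding closed_sequential_limits by blast
qed

section \<open>Closedness of the sum\<close>

text \<open>Differences of terms stay in the subspace \<open>S\<close>, so the lower bound applies
  to them and controls them by differences of images.\<close>

lemma bounded_below_Cauchy:
  fixes A :: "'a::real_normed_vector \<Rightarrow> 'b::real_normed_vector"
  assumes A: "bounded_linear A" and C: "\<And>x. x \<in> S \<Longrightarrow> norm x \<le> C * norm (A x)"
    and S: "subspace S" "\<And>n. x n \<in> S" and c: "Cauchy (\<lambda>n. A (x n))"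
  shows "Cauchy x"
proof (rule CauchyI)
  fix e :: real assume "e > 0"
  interpret A: bounded_linear A by fact
  \<comment> \<open>The maximum with 1 guarantees a positive constant by which \<open>e\<close> can
    be divided.\<close>
  define D where "D = max C 1"
  have "D > 0" by (simp add: D_def)
  have le: "norm (x m - x n) \<le> D * norm (A (x m) - A (x n))" for m n
  proof -
    have "norm (x m - x n) \<le> C * norm (A (x m - x n))"
      using S by (intro C subspace_diff)
    also have "\<dots> \<le> D * norm (A (x m - x n))" by (intro mult_right_mono) (auto simp: D_def)
    finally show ?thesis by (simp add: A.diff)
  qed
  obtain M where M: "\<And>m n. m \<ge> M \<Longrightarrow> n \<ge> M \<Longrightarrow> norm (A (x m) - A (x n)) < e / D"
    using CauchyD[OF c, of "e / D"] \<open>e > 0\<close> \<open>D > 0\<close> by auto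
  show "\<exists>M. \<forall>m\<ge>M. \<forall>n\<ge>M. norm (x m - x n) < e"
  proof (intro exI allI impI)
    fix m n assume "m \<ge> M" "n \<ge> M"
    from M[OF this] have "D * norm (A (x m) - A (x n)) < e"
      using \<open>D > 0\<close> by (simp add: field_simps)
    then show "norm (x m - x n) < e" using le[of m n] by linarith
  qed
qed

theorem corollary1:
  fixes A :: "nat \<Rightarrow> 'h::complex_hilbert_space \<Rightarrow> 'h" and N :: nat
  assumes "N \<ge> 2"
    and "\<And>i. i \<in> {1..N} \<Longrightarrow> bounded_clinear (A i)"
    and "\<And>i. i \<in> {1..N} \<Longrightarrow> self_adjoint (A i)"
    and "\<And>i j. i \<in> {1..N} \<Longrightarrow> j \<in> {1..N} \<Longrightarrow> i \<noteq> j \<Longrightarrow> compact_operator (A i \<circ> A j)"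
    and "\<And>i. i \<in> {1..N} \<Longrightarrow> closed (range (A i))"
  shows "closed (sum_of_ranges N A)"
proof -
  let ?I = "{1..N}"
  have lin: "bounded_linear (A i)" if "i \<in> ?I" for i
    using assms(2)[OF that] by (simp add: bounded_clinear_def)
  have "\<exists>C\<ge>0. \<forall>y\<in>range (A i). \<exists>u. A i u = y \<and> norm u \<le> C * norm y" if "i \<in> ?I" for i
    using closed_range_bounded_preimages[OF lin[OF that] assms(5)[OF that]] by metis
  then obtain C where C: "\<And>i. i \<in> ?I \<Longrightarrow> C i \<ge> 0"
    "\<And>i y. i \<in> ?I \<Longrightarrow> y \<in> range (A i) \<Longrightarrow> \<exists>u. A i u = y \<and> norm u \<le> C i * norm y"
    by metis
  have below: "norm x \<le> C i * norm (A i x)" if "i \<in> ?I" "x \<in> range (A i)" for i x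
    using self_adjoint_bounded_below_on_range assms(3) C that by metis
  have sub: "subspace (range (A i))" if "i \<in> ?I" for i
    using lin[OF that] linear_subspace_image[of "A i" UNIV] by (simp add: bounded_linear.linear)
  have "closed {\<Sum>i\<in>?I. x i | x. \<forall>i\<in>?I. x i \<in> range (A i)}"
  proof (rule closed_sum_of_subspaces)
    fix x :: "nat \<Rightarrow> nat \<Rightarrow> 'h" and B
    assume xR: "\<And>i n. i \<in> ?I \<Longrightarrow> x n i \<in> range (A i)"
      and xB: "\<And>i n. i \<in> ?I \<Longrightarrow> norm (x n i) \<le> B"
      and conv: "convergent (\<lambda>n. \<Sum>i\<in>?I. x n i)"
    have "\<forall>i n. \<exists>u. i \<in> ?I \<longrightarrow> A i u = x n i \<and> norm u \<le> C i * norm (x n i)"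
      using C(2) xR by blast
    then obtain u where u: "\<And>i n. i \<in> ?I \<Longrightarrow> A i (u i n) = x n i"
      "\<And>i n. i \<in> ?I \<Longrightarrow> norm (u i n) \<le> C i * norm (x n i)"
      by metis
    \<comment> \<open>The off-diagonal pairs: for these
      \<open>A j (x n i) = A j (A i (u i n))\<close> with \<open>u i n\<close> bounded, so the
      values lie in the compact set \<open>K (i, j)\<close>.\<close>
    define J where "J = {(i, j). i \<in> ?I \<and> j \<in> ?I \<and> i \<noteq> j}"
    define K where "K = (\<lambda>(i, j). closure ((A j \<circ> A i) ` cball 0 (C i * B)))"
    define f where "f = (\<lambda>(i, j) n. A j (x n i))"
    have "\<exists>r::nat \<Rightarrow> nat. strict_mono r \<and> (\<forall>p\<in>J. convergent (f p \<circ> r))"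
    proof (rule common_convergent_subsequence)
      show "finite J" by (rule finite_subset[of _ "?I \<times> ?I"]) (auto simp: J_def)
      show "compact (K p)" if "p \<in> J" for p
        using that assms(4) by (auto simp: J_def K_def compact_operator_def)
      show "f p n \<in> K p" if pJ: "p \<in> J" for p n
      proof -
        obtain i j where p: "p = (i, j)" "i \<in> ?I" using pJ unfolding J_def by blast
        have "norm (u i n) \<le> C i * B"
          using u(2)[OF p(2), of n] mult_left_mono[OF xB[OF p(2), of n] C(1)[OF p(2)]] by linarith
        then have "(A j \<circ> A i) (u i n) \<in> K p"
          unfolding p K_def prod.case by (intro closure_subset[THEN subsetD] imageI) simp
        then show ?thesis using u(1)[OF p(2)] by (simp add: p f_def)
      qed
    qed
    then obtain r where r: "strict_mono (r::nat \<Rightarrow> nat)"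
      "\<And>i j. i \<in> ?I \<Longrightarrow> j \<in> ?I \<Longrightarrow> i \<noteq> j \<Longrightarrow> convergent (\<lambda>n. A j (x (r n) i))"
      by (force simp: J_def f_def o_def)
    have "convergent (\<lambda>n. x (r n) j)" if j: "j \<in> ?I" for j
    proof -
      interpret A: bounded_linear "A j" using lin j .
      \<comment> \<open>The diagonal term, which compactness does not reach, is isolated by applying
        \<open>A j\<close> to the convergent sum; everything on the right converges.\<close>
      have "A j (x (r n) j) = A j (\<Sum>i\<in>?I. x (r n) i) - (\<Sum>i\<in>?I - {j}. A j (x (r n) i))" for n
        using j by (subst sum.remove[of ?I j]) (auto simp: A.add A.sum)
      moreover have "convergent (\<lambda>n. A j (\<Sum>i\<in>?I. x (r n) i))"
        using convergent_subseq_convergent[OF conv r(1)] A.tendsto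
        by (auto simp: convergent_def o_def)
      moreover have "convergent (\<lambda>n. \<Sum>i\<in>?I - {j}. A j (x (r n) i))"
        using r(2) j by (intro convergent_sum) auto
      ultimately have "convergent (\<lambda>n. A j (x (r n) j))"
        by (simp add: convergent_diff)
      then have "Cauchy (\<lambda>n. x (r n) j)"
        using bounded_below_Cauchy[OF lin[OF j] below[OF j] sub[OF j], of "\<lambda>n. x (r n) j"] xR[OF j]
        by (simp add: Cauchy_convergent_iff)
      then show ?thesis by (simp add: Cauchy_convergent_iff)
    qed
    then show "\<exists>r::nat \<Rightarrow> nat. strict_mono r \<and> (\<forall>i\<in>?I. convergent (\<lambda>n. x (r n) i))"
      using r(1) by blast
  qed (use sub assms(5) in auto)
  also have "{\<Sum>i\<in>?I. x i | x. \<forall>i\<in>?I. x i \<in> range (A i)} = sum_of_ranges N A"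
  proof -
    \<comment> \<open>Choosing preimages index by index turns a tuple of range elements into the
      tuple of arguments used by \<open>sum_of_ranges\<close>.\<close>
    have "\<exists>u. (\<Sum>i\<in>?I. x i) = (\<Sum>i\<in>?I. A i (u i))" if "\<forall>i\<in>?I. x i \<in> range (A i)" for x
    proof -
      from that have "\<forall>i\<in>?I. \<exists>u. x i = A i u" by auto
      then obtain u where "\<forall>i\<in>?I. x i = A i (u i)" by metis
      then show ?thesis by (intro exI[of _ u] sum.cong) auto
    qed
    then show ?thesis unfolding sum_of_ranges_def by auto
  qed
  finally show ?thesis .
qed

end
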